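(* Let $Z,Y$ be real Banach spaces and let $b:Z\times Y\to\mathbb{R}$ be a bilinear form such that, for some $M>0$, $|b(z,y)|\le M\|z\|_Z\|y\|_Y$ for all $z\in Z$, $y\in Y$. Let $(X_n)_{n\in\mathbb{N}}$ and $(Y_n)_{n\in\mathbb{N}}$ be sequences of finite dimensional subspaces of $Z$ and $Y$, respectively, with $\dim X_n=\dim Y_n$ for all $n\in\mathbb{N}$. Assume that there is $\beta>0$ such that $$\sup_{y\in Y_n,\ \|y\|_Y=1} b(x,y)\ge \beta\|x\|_Z\quad\text{for all }x\in X_n\text{ and all }n\in\mathbb{N}.$$ Let $L\in Y'$ and let $\widehat{x}\in Z$ satisfy $b(\widehat{x},y)=L(y)$ for all $y\in Y$. For every $n\in\mathbb{N}$ let $x_n$ be the unique element of $X_n$ such that $b(x_n,y)=L(y)$ for all $y\in Y_n$. Then for every $n\in\mathbb{N}$ $$\|x_n-\widehat{x}\|_Z\le\Big(1+\frac{M}{\beta}\Big)\min_{x\in X_n}\|x-\widehat{x}\|_Z,$$ $$\|x_n-x\|_Z\le\frac{M}{\beta}\|x-\widehat{x}\|_Z\quad\text{for all }x\in X_n,$$ and, if $Z$ is a Hilbert space, $$\|x_n-\widehat{x}\|_Z\le\frac{M}{\beta}\min_{x\in X_n}\|x-\widehat{x}\|_Z.$$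
   Context: $Y'$ denotes the topological dual of $Y$. The existence and uniqueness of $x_n$ follow from the inf-sup hypothesis and $\dim X_n=\dim Y_n<\infty$. *)

theory Defs
  imports "HOL-Analysis.Analysis"
begin

definition finite_dim_subspace :: "'a::real_vector set \<Rightarrow> bool" where
  "finite_dim_subspace V \<longleftrightarrow> subspace V \<and> (\<exists>B. finite B \<and> V = span B)"

text \<open>
  Being a Hilbert space appears below as a hypothesis on a given Banach space, so it cannot be
  the class \<^class>\<open>real_inner\<close>, which is fixed together with the type.
  Completeness comes from \<^class>\<open>banach\<close>.
\<close>

definition hilbertian :: "'a::banach itself \<Rightarrow> bool" where
  "hilbertian _ \<longleftrightarrow>
     (\<exists>ip :: 'a \<Rightarrow> 'a \<Rightarrow> real.
        bilinear ip \<and>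
        (\<forall>x y. ip x y = ip y x) \<and>
        (\<forall>x. x \<noteq> 0 \<longrightarrow> ip x x > 0) \<and>
        (\<forall>x. norm x = sqrt (ip x x)))"

text \<open>
  The supremum is taken in the extended reals: the unit sphere of the zero space is empty, and
  its supremum is \<open>-\<infinity>\<close>, whereas \<open>Sup {}\<close> is unspecified in type \<^typ>\<open>real\<close>.
\<close>

definition inf_sup_condition ::
    "('a::real_normed_vector \<Rightarrow> 'b::real_normed_vector \<Rightarrow> real) \<Rightarrow> real \<Rightarrow> 'a set \<Rightarrow> 'b set \<Rightarrow> bool" where
  "inf_sup_condition b \<beta> V W \<longleftrightarrow>
     (\<forall>x\<in>V. (SUP y\<in>{y\<in>W. norm y = 1}. ereal (b x y)) \<ge> ereal (\<beta> * norm x))"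

definition is_galerkin_solution ::
    "('a \<Rightarrow> 'b \<Rightarrow> real) \<Rightarrow> ('b \<Rightarrow> real) \<Rightarrow> 'a set \<Rightarrow> 'b set \<Rightarrow> 'a \<Rightarrow> bool" where
  "is_galerkin_solution b L V W x \<longleftrightarrow> x \<in> V \<and> (\<forall>y\<in>W. b x y = L y)"

definition is_minimum :: "real \<Rightarrow> real set \<Rightarrow> bool" where
  "is_minimum m S \<longleftrightarrow> m \<in> S \<and> (\<forall>s\<in>S. m \<le> s)"

end

theory Submission
  imports Defs
begin

text \<open>
  Since \<open>b (xhat - xs n) y = 0\<close> on \<open>Y n\<close>, the inf-sup condition applied to \<open>xs n - x\<close> gives
  \<open>\<beta> * norm (xs n - x) \<le> M * norm (xhat - x)\<close>, and the triangle inequality yields the first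
  estimate. In the Hilbert case put \<open>u = xhat - xs n\<close> and \<open>p = xs n - x\<close>. The same argument gives
  \<open>norm (\<alpha> *\<^sub>R p) \<le> M / \<beta> * norm (\<alpha> *\<^sub>R p + \<gamma> *\<^sub>R u)\<close> for all scalars; exchanging the
  lengths of \<open>p\<close> and \<open>u\<close>, which leaves the norm of the sum unchanged, turns this into
  \<open>norm u \<le> M / \<beta> * norm (p + u)\<close>.
\<close>

section \<open>Best approximation in finite dimensional subspaces\<close>

text \<open>Points of norm above \<open>2 * norm z\<close> are farther from \<open>z\<close> than
  \<open>0\<close> is, so minimizing over a compact piece suffices. Compactness is a hypothesis
  because the lemma is used inside the induction that proves it for spans.\<close>

lemma norm_minimizer_exists:
  fixes V :: "'a::real_normed_vector set"
  assumes "0 \<in> V" and compact: "\<And>r. compact (V \<inter> cball 0 r)"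
  obtains x where "x \<in> V" "\<And>v. v \<in> V \<Longrightarrow> norm (x - z) \<le> norm (v - z)"
proof -
  let ?K = "V \<inter> cball 0 (2 * norm z)"
  have "\<exists>x\<in>?K. \<forall>v\<in>?K. norm (x - z) \<le> norm (v - z)"
    using assms(1) by (intro continuous_attains_inf compact continuous_intros) auto
  then obtain x where x: "x \<in> ?K" "\<And>v. v \<in> ?K \<Longrightarrow> norm (x - z) \<le> norm (v - z)" by blast
  have "norm (x - z) \<le> norm (v - z)" if "v \<in> V" for v
  proof (cases "norm v \<le> 2 * norm z")
    case True
    then show ?thesis using that x(2) by simp
  next
    case False
    have "norm (x - z) \<le> norm z" using x(2)[of 0] assms(1) by simp
    also have "\<dots> \<le> norm (v - z)" using False norm_triangle_ineq2[of v z] by simp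
    finally show ?thesis .
  qed
  then show thesis using that x(1) by blast
qed

text \<open>A new vector \<open>a\<close> outside \<open>span B\<close> has positive distance from
  it, attained by the induction hypothesis. This bounds the coefficient of \<open>a\<close>, so the
  ball lies in a continuous image of a compact product.\<close>

lemma compact_span_Int_cball:
  fixes B :: "'a::real_normed_vector set"
  assumes "finite B"
  shows "compact (span B \<inter> cball 0 r)"
  using assms
proof (induction B arbitrary: r rule: finite_induct)
  case empty
  then show ?case by (simp add: Int_commute finite_imp_compact)
next
  case (insert a B)
  show ?case
  proof (cases "a \<in> span B")
    case True
    then show ?thesis using insert.IH by (simp add: span_redundant)
  next
    case False
    obtain c where c: "c \<in> span B" "\<And>v. v \<in> span B \<Longrightarrow> norm (c - a) \<le> norm (v - a)"
      using norm_minimizer_exists[OF span_zero insert.IH] by blast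
    define d where "d = norm (c - a)"
    have d: "d > 0" using c(1) False unfolding d_def by auto
    \<comment> \<open>Dividing \<open>t *\<^sub>R a + v\<close> by \<open>- t\<close> gives an
      element of \<open>span B\<close> minus \<open>a\<close>, whose norm is at least
      \<open>d\<close>.\<close>
    have coord: "\<bar>t\<bar> * d \<le> norm (t *\<^sub>R a + v)" if "v \<in> span B" for t v
    proof (cases "t = 0")
      case False
      have "d \<le> norm ((- 1 / t) *\<^sub>R v - a)"
        unfolding d_def by (intro c(2) span_scale that)
      then have "\<bar>t\<bar> * d \<le> norm (t *\<^sub>R ((- 1 / t) *\<^sub>R v - a))"
        by (simp add: mult_left_mono)
      also have "t *\<^sub>R ((- 1 / t) *\<^sub>R v - a) = - (t *\<^sub>R a + v)"
        using False by (simp add: scaleR_diff_right)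
      finally show ?thesis by (simp only: norm_minus_cancel)
    qed simp
    let ?f = "\<lambda>(t, v). t *\<^sub>R a + v"
    \<comment> \<open>The first factor comes from \<open>coord\<close>, the radius of the second
      from the triangle inequality for \<open>x - t *\<^sub>R a\<close>.\<close>
    let ?K = "{- (r / d)..r / d} \<times> (span B \<inter> cball 0 (r + r / d * norm a))"
    have "compact (?f ` ?K)"
      by (intro compact_continuous_image compact_Times insert.IH compact_Icc)
        (auto simp: case_prod_unfold intro!: continuous_intros)
    moreover have "span (insert a B) \<inter> cball 0 r = ?f ` ?K \<inter> cball 0 r"
    proof (intro equalityI subsetI)
      fix x assume x: "x \<in> span (insert a B) \<inter> cball 0 r"
      then obtain t where t: "x - t *\<^sub>R a \<in> span B"
        using span_breakdown_eq[of x a B] by auto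
      have "\<bar>t\<bar> * d \<le> r" using coord[OF t, of t] x by simp
      then have tb: "\<bar>t\<bar> \<le> r / d" using d by (simp add: pos_le_divide_eq)
      have "norm (x - t *\<^sub>R a) \<le> norm x + \<bar>t\<bar> * norm a"
        using norm_triangle_ineq4[of x "t *\<^sub>R a"] by simp
      also have "\<dots> \<le> r + r / d * norm a"
        using x tb by (intro add_mono mult_right_mono) auto
      finally have "(t, x - t *\<^sub>R a) \<in> ?K" using t tb by auto
      then have "?f (t, x - t *\<^sub>R a) \<in> ?f ` ?K" by (rule imageI)
      then show "x \<in> ?f ` ?K \<inter> cball 0 r" using x by simp
    next
      fix x assume x: "x \<in> ?f ` ?K \<inter> cball 0 r"
      then obtain t v where "x = t *\<^sub>R a + v" "v \<in> span B" by auto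
      then have "x - t *\<^sub>R a \<in> span B" by simp
      then show "x \<in> span (insert a B) \<inter> cball 0 r"
        using x span_breakdown_eq[of x a B] by auto
    qed
    ultimately show ?thesis by (simp add: compact_Int_closed)
  qed
qed

lemma finite_dim_subspace_norm_minimizer:
  fixes V :: "'a::real_normed_vector set"
  assumes "finite_dim_subspace V"
  obtains m where "is_minimum m ((\<lambda>x. norm (x - z)) ` V)"
proof -
  obtain B where B: "finite B" "V = span B"
    using assms unfolding finite_dim_subspace_def by blast
  obtain x where "x \<in> V" "\<And>v. v \<in> V \<Longrightarrow> norm (x - z) \<le> norm (v - z)"
    using norm_minimizer_exists[OF span_zero compact_span_Int_cball[OF B(1)]] B(2) by blast
  then show thesis using that[of "norm (x - z)"] unfolding is_minimum_def by auto
qed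

section \<open>Bases and dimension count\<close>

lemma finite_dim_subspace_basis:
  fixes V :: "'a::real_vector set"
  assumes "finite_dim_subspace V"
  obtains B where "finite B" "independent B" "V = span B" "card B = dim V"
proof -
  obtain S where S: "finite S" "V = span S"
    using assms unfolding finite_dim_subspace_def by blast
  obtain B where B: "B \<subseteq> V" "independent B" "V \<subseteq> span B" "card B = dim V"
    using basis_exists by blast
  have "finite B" using independent_span_bound[of S B] S B(1,2) by simp
  moreover have "V = span B"
    using B(1,3) span_minimal[of B V] assms unfolding finite_dim_subspace_def by blast
  ultimately show thesis using that B by blast
qed

lemma linear_image_span_eq_if_inj_on:
  fixes T :: "'a::real_vector \<Rightarrow> 'b::real_vector"
  assumes T: "linear T" and inj: "inj_on T (span C)" and sub: "T ` C \<subseteq> span B"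
    and C: "finite C" "independent C" and B: "finite B" and card: "card B \<le> card C"
  shows "T ` span C = span B"
proof -
  have ind: "independent (T ` C)"
    using T C(2) inj by (rule linear_independent_injective_image)
  have card_eq: "card (T ` C) = card C"
    by (rule card_image[OF inj_on_subset[OF inj span_superset]])
  have "y \<in> span (T ` C)" if y: "y \<in> span B" for y
  proof (rule ccontr)
    assume ny: "y \<notin> span (T ` C)"
    have ind_y: "independent (insert y (T ` C))"
      using ny ind by (rule independent_insertI)
    have "insert y (T ` C) \<subseteq> span B" using sub y by simp
    then have "card (insert y (T ` C)) \<le> card B"
      using independent_span_bound[OF B ind_y] by blast
    moreover have "y \<notin> T ` C" using ny by (metis span_base)
    ultimately show False using C(1) card card_eq by simp
  qed
  moreover have "span (T ` C) \<subseteq> span B" by (rule span_minimal[OF sub subspace_span])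
  ultimately show ?thesis unfolding linear_span_image[OF T, symmetric] by blast
qed

section \<open>Consequences of the inf-sup condition\<close>

text \<open>An upper bound on the unit sphere bounds the supremum even if the sphere is empty. A
  negative \<open>c\<close> is allowed, which serves to rule out trivial spaces.\<close>

lemma inf_sup_bound:
  fixes b :: "'a::real_normed_vector \<Rightarrow> 'b::real_normed_vector \<Rightarrow> real"
  assumes "inf_sup_condition b \<beta> V W" "x \<in> V"
    and "\<And>y. y \<in> W \<Longrightarrow> norm y = 1 \<Longrightarrow> b x y \<le> c"
  shows "\<beta> * norm x \<le> c"
proof -
  have "ereal (\<beta> * norm x) \<le> (SUP y\<in>{y\<in>W. norm y = 1}. ereal (b x y))"
    using assms(1,2) unfolding inf_sup_condition_def by blast
  also have "\<dots> \<le> ereal c" using assms(3) by (intro SUP_least) auto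
  finally show ?thesis by simp
qed

lemma inf_sup_nondegenerate:
  fixes b :: "'a::real_normed_vector \<Rightarrow> 'b::real_normed_vector \<Rightarrow> real"
  assumes "inf_sup_condition b \<beta> V W" "\<beta> > 0" "x \<in> V" "\<And>y. y \<in> W \<Longrightarrow> b x y = 0"
  shows "x = 0"
  using inf_sup_bound[OF assms(1,3), of 0] assms(2,4) by (simp add: mult_le_0_iff)

text \<open>On the trivial space \<open>{0}\<close> the supremum in the inf-sup condition is \<open>-\<infinity>\<close>.\<close>

lemma inf_sup_nontrivial:
  fixes b :: "'a::real_normed_vector \<Rightarrow> 'b::real_normed_vector \<Rightarrow> real"
  assumes inf_sup: "inf_sup_condition b \<beta> V W"
    and V: "finite_dim_subspace V" and W: "finite_dim_subspace W" and dim: "dim V = dim W"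
  obtains q where "q \<in> V" "q \<noteq> 0"
proof (rule ccontr)
  assume "\<not> thesis"
  then have V0: "V \<subseteq> {0}" using that by blast
  obtain C where C: "independent C" "V = span C" "card C = dim V"
    using finite_dim_subspace_basis[OF V] .
  have "C \<subseteq> {0}" using V0 C(2) span_superset[of C] by blast
  moreover have "0 \<notin> C" using C(1) dependent_zero by blast
  ultimately have "C = {}" by blast
  then have "dim W = 0" using C(3) dim by simp
  moreover obtain B where "finite B" "W = span B" "card B = dim W"
    using finite_dim_subspace_basis[OF W] .
  ultimately have "W \<subseteq> {0}" by simp
  \<comment> \<open>Vacuous, as \<open>W\<close> has no unit vector; any negative constant would
    do.\<close>
  then have "b 0 y \<le> - 1" if "y \<in> W" "norm y = 1" for y
    using that by auto
  moreover have "0 \<in> V" using V by (simp add: finite_dim_subspace_def subspace_0)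
  ultimately show False using inf_sup_bound[OF inf_sup, of 0 "-1"] by simp
qed

section \<open>Unique solvability of the discrete problem\<close>

text \<open>Testing against a basis of \<open>W\<close> gives a square linear system; the inf-sup
  condition makes it injective, and the dimension count makes it surjective.\<close>

lemma galerkin_solution_ex1:
  fixes b :: "'a::real_normed_vector \<Rightarrow> 'b::real_normed_vector \<Rightarrow> real"
  assumes b: "bilinear b" and L: "linear L" and \<beta>: "\<beta> > 0"
    and V: "finite_dim_subspace V" and W: "finite_dim_subspace W" and dim: "dim V = dim W"
    and inf_sup: "inf_sup_condition b \<beta> V W"
  shows "\<exists>!x. is_galerkin_solution b L V W x"
proof -
  obtain C where C: "finite C" "independent C" "V = span C" "card C = dim V"
    using finite_dim_subspace_basis[OF V] .
  obtain B where B: "finite B" "independent B" "W = span B" "card B = dim W"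
    using finite_dim_subspace_basis[OF W] .
  have lin: "linear (b x)" "linear (\<lambda>x. b x y)" for x y
    using b unfolding bilinear_def by auto
  have eq_on_W: "b x y = f y" if "linear f" "\<And>e. e \<in> B \<Longrightarrow> b x e = f e" "y \<in> W" for x y f
    using linear_eq_on[OF lin(1) that(1)] that(2,3) B(3) by blast
  \<comment> \<open>The values \<open>b x e\<close> are stored as coordinates in the basis
    \<open>B\<close>, so that \<open>T\<close> maps \<open>V\<close> into a space of the same
    dimension.\<close>
  define T where "T x = (\<Sum>e\<in>B. b x e *\<^sub>R e)" for x
  have T: "linear T"
    unfolding T_def
    by (rule linearI)
      (simp_all add: linear_add[OF lin(2)] linear_cmul[OF lin(2)] scaleR_add_left sum.distrib
        scaleR_sum_right)
  have coeff_eq: "f e = g e" if "(\<Sum>e\<in>B. f e *\<^sub>R e) = (\<Sum>e\<in>B. g e *\<^sub>R e)" "e \<in> B" for f g e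
  proof -
    have "(\<Sum>e\<in>B. (f e - g e) *\<^sub>R e) = 0"
      using that(1) by (simp add: scaleR_diff_left sum_subtractf)
    then have "f e - g e = 0"
      by (rule independentD[OF B(2,1) subset_refl, where u = "\<lambda>e. f e - g e"]) (rule that(2))
    then show ?thesis by simp
  qed
  have V_eqI: "x = x'" if "x \<in> V" "x' \<in> V" "\<And>e. e \<in> B \<Longrightarrow> b x e = b x' e" for x x'
  proof -
    have "b (x - x') y = 0" if "y \<in> W" for y
      using eq_on_W[OF lin(1) \<open>\<And>e. e \<in> B \<Longrightarrow> b x e = b x' e\<close> that]
      by (simp add: bilinear_lsub[OF b])
    then have "x - x' = 0"
      using inf_sup_nondegenerate[OF inf_sup \<beta>, of "x - x'"] that(1,2) C(3)
      by (simp add: span_diff)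
    then show ?thesis by simp
  qed
  have "inj_on T (span C)"
    using V_eqI coeff_eq C(3) unfolding T_def inj_on_def by blast
  moreover have "T ` C \<subseteq> span B"
    unfolding T_def by (auto intro!: span_sum span_scale intro: span_base)
  ultimately have "T ` V = span B"
    using linear_image_span_eq_if_inj_on[OF T] B C dim by simp
  \<comment> \<open>The right-hand side in the same coordinates: a preimage under \<open>T\<close>
    solves the equation on \<open>B\<close>, hence on \<open>W\<close>.\<close>
  moreover have "(\<Sum>e\<in>B. L e *\<^sub>R e) \<in> span B"
    by (auto intro!: span_sum span_scale intro: span_base)
  ultimately have "(\<Sum>e\<in>B. L e *\<^sub>R e) \<in> T ` V" by simp
  then obtain x where x: "x \<in> V" "T x = (\<Sum>e\<in>B. L e *\<^sub>R e)" by auto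
  then have "b x e = L e" if "e \<in> B" for e
    using coeff_eq[of "b x" L] that unfolding T_def by blast
  then have "is_galerkin_solution b L V W x"
    using eq_on_W[OF L] x(1) unfolding is_galerkin_solution_def by blast
  moreover have "x' = x''"
    if "is_galerkin_solution b L V W x'" "is_galerkin_solution b L V W x''" for x' x''
    using that B(3) unfolding is_galerkin_solution_def by (intro V_eqI) (auto simp: span_base)
  ultimately show ?thesis by blast
qed

section \<open>Error estimates\<close>

text \<open>The two factors have product 1, so the mixed term of the expanded square is unchanged,
  while the two squared lengths trade places.\<close>

lemma hilbertian_norm_swap:
  fixes p u :: "'a::banach"
  assumes "hilbertian TYPE('a)" "p \<noteq> 0" "u \<noteq> 0"
  shows "norm ((norm u / norm p) *\<^sub>R p + (norm p / norm u) *\<^sub>R u) = norm (p + u)"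
proof -
  obtain ip :: "'a \<Rightarrow> 'a \<Rightarrow> real" where ip: "bilinear ip" "\<And>x y. ip x y = ip y x"
    and norm_ip: "\<And>x. norm x = sqrt (ip x x)" and pos: "\<And>x. x \<noteq> 0 \<Longrightarrow> ip x x > 0"
    using assms(1) unfolding hilbertian_def by blast
  have ip_self: "ip x x = (norm x)\<^sup>2" for x
    using norm_ip[of x] pos[of x] bilinear_lzero[OF ip(1), of 0] by (cases "x = 0") auto
  have expand: "ip (s *\<^sub>R p + t *\<^sub>R u) (s *\<^sub>R p + t *\<^sub>R u)
      = s\<^sup>2 * ip p p + 2 * (s * t) * ip p u + t\<^sup>2 * ip u u" for s t
    by (simp add: bilinear_ladd[OF ip(1)] bilinear_radd[OF ip(1)] bilinear_lmul[OF ip(1)]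
        bilinear_rmul[OF ip(1)] ip(2)[of u p] power2_eq_square algebra_simps)
  have "ip ((norm u / norm p) *\<^sub>R p + (norm p / norm u) *\<^sub>R u)
          ((norm u / norm p) *\<^sub>R p + (norm p / norm u) *\<^sub>R u) = ip (p + u) (p + u)"
    using expand[of "norm u / norm p" "norm p / norm u"] expand[of 1 1] assms(2,3)
    by (simp add: ip_self[of p] ip_self[of u] power_divide)
  then show ?thesis using norm_ip by simp
qed

theorem lemma2p11:
  fixes b :: "'z::banach \<Rightarrow> 'y::banach \<Rightarrow> real"
    and M \<beta> :: real
    and X :: "nat \<Rightarrow> 'z set"
    and Y :: "nat \<Rightarrow> 'y set"
    and L :: "'y \<Rightarrow> real"
    and xhat :: 'z
    and xs :: "nat \<Rightarrow> 'z"
  assumes "bilinear b"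
    and "M > 0"
    and "\<And>z y. \<bar>b z y\<bar> \<le> M * norm z * norm y"
    and "\<And>n. finite_dim_subspace (X n)"
    and "\<And>n. finite_dim_subspace (Y n)"
    and "\<And>n. dim (X n) = dim (Y n)"
    and "\<beta> > 0"
    and "\<And>n. inf_sup_condition b \<beta> (X n) (Y n)"
    and "bounded_linear L"
    and "\<And>y. b xhat y = L y"
    and "\<And>n. xs n = (THE x. is_galerkin_solution b L (X n) (Y n) x)"
  shows "\<forall>n. (\<exists>!x. is_galerkin_solution b L (X n) (Y n) x) \<and>
    (\<exists>m. is_minimum m ((\<lambda>x. norm (x - xhat)) ` X n) \<and>
         norm (xs n - xhat) \<le> (1 + M / \<beta>) * m \<and>
         (\<forall>x\<in>X n. norm (xs n - x) \<le> M / \<beta> * norm (x - xhat)) \<and>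
         (hilbertian TYPE('z) \<longrightarrow> norm (xs n - xhat) \<le> M / \<beta> * m))"
proof
  fix n
  note b = \<open>bilinear b\<close> and \<beta> = \<open>\<beta> > 0\<close> and inf_sup = assms(8)[of n]
  have ex1: "\<exists>!x. is_galerkin_solution b L (X n) (Y n) x"
    using galerkin_solution_ex1[OF b bounded_linear.linear[OF assms(9)] \<beta>] assms(4-6,8) by blast
  have "is_galerkin_solution b L (X n) (Y n) (xs n)"
    unfolding assms(11) by (rule theI'[OF ex1])
  then have xs: "xs n \<in> X n" and xs_eq: "\<And>y. y \<in> Y n \<Longrightarrow> b (xs n) y = L y"
    unfolding is_galerkin_solution_def by auto
  have sub: "subspace (X n)" using assms(4) unfolding finite_dim_subspace_def by blast
  obtain m where m: "is_minimum m ((\<lambda>x. norm (x - xhat)) ` X n)"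
    using finite_dim_subspace_norm_minimizer[OF assms(4)] .
  then obtain x0 where x0: "x0 \<in> X n" "m = norm (x0 - xhat)"
    unfolding is_minimum_def by auto
  define u where "u = xhat - xs n"
  \<comment> \<open>Galerkin orthogonality of the error.\<close>
  have orth: "b u y = 0" if "y \<in> Y n" for y
    using xs_eq[OF that] assms(10) by (simp add: u_def bilinear_lsub[OF b])
  \<comment> \<open>By \<open>orth\<close>, adding a multiple of \<open>u\<close> does not change
    \<open>b p y\<close>. The scalar \<open>t\<close> stays free for the Hilbert case.\<close>
  have stab: "norm p \<le> M / \<beta> * norm (p + t *\<^sub>R u)" if "p \<in> X n" for p t
  proof -
    have "b p y \<le> M * norm (p + t *\<^sub>R u)" if "y \<in> Y n" "norm y = 1" for y
      using assms(3)[of "p + t *\<^sub>R u" y] orth that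
      by (simp add: bilinear_ladd[OF b] bilinear_lmul[OF b])
    then have "\<beta> * norm p \<le> M * norm (p + t *\<^sub>R u)" by (rule inf_sup_bound[OF inf_sup that])
    then show ?thesis using \<beta> by (simp add: field_simps)
  qed
  \<comment> \<open>Here \<open>p + u\<close> is \<open>xhat - x\<close>.\<close>
  have quasi: "norm (xs n - x) \<le> M / \<beta> * norm (x - xhat)" if "x \<in> X n" for x
    using stab[of "xs n - x" 1] subspace_diff[OF sub xs that]
    by (simp add: u_def norm_minus_commute)
  have "norm (xs n - xhat) \<le> norm (xs n - x0) + norm (x0 - xhat)"
    using norm_triangle_ineq[of "xs n - x0" "x0 - xhat"] by simp
  also have "\<dots> \<le> (1 + M / \<beta>) * m"
    using quasi[OF x0(1)] x0(2) by (simp add: distrib_right)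
  finally have est: "norm (xs n - xhat) \<le> (1 + M / \<beta>) * m" .
  have "norm (xs n - xhat) \<le> M / \<beta> * m" if H: "hilbertian TYPE('z)"
  proof -
    define p where "p = xs n - x0"
    have p: "p \<in> X n" unfolding p_def by (rule subspace_diff[OF sub xs x0(1)])
    have pu: "norm (p + u) = m" unfolding p_def u_def x0(2) by (simp add: norm_minus_commute)
    have "norm u \<le> M / \<beta> * norm (p + u)"
    proof (cases "p = 0 \<or> u = 0")
      case True
      \<comment> \<open>For \<open>p = 0\<close> the claim amounts to \<open>M / \<beta>\<close>
        being at least 1 unless \<open>u = 0\<close>; any nonzero \<open>q\<close> in
        \<open>X n\<close> shows this.\<close>
      obtain q where q: "q \<in> X n" "q \<noteq> 0"
        using inf_sup_nontrivial[OF inf_sup] assms(4-6) by blast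
      have "1 * norm q \<le> M / \<beta> * norm q" using stab[OF q(1), of 0] by simp
      then have "1 \<le> M / \<beta>" by (rule mult_right_le_imp_le) (simp add: q(2))
      then have "1 * norm u \<le> M / \<beta> * norm u" by (rule mult_right_mono) simp
      moreover have "0 \<le> M / \<beta> * norm p" using \<open>M > 0\<close> \<beta> by simp
      ultimately show ?thesis using True by auto
    next
      case False
      have "norm u = norm ((norm u / norm p) *\<^sub>R p)" using False by simp
      \<comment> \<open>The multiple of \<open>u\<close> is chosen to fit
        \<open>hilbertian_norm_swap\<close>.\<close>
      also have "\<dots> \<le> M / \<beta> * norm ((norm u / norm p) *\<^sub>R p + (norm p / norm u) *\<^sub>R u)"
        by (intro stab subspace_scale[OF sub] p)
      also have "\<dots> = M / \<beta> * norm (p + u)" using hilbertian_norm_swap[OF H] False by simp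
      finally show ?thesis .
    qed
    then show ?thesis using pu by (simp add: u_def norm_minus_commute)
  qed
  then show "(\<exists>!x. is_galerkin_solution b L (X n) (Y n) x) \<and>
    (\<exists>m. is_minimum m ((\<lambda>x. norm (x - xhat)) ` X n) \<and>
         norm (xs n - xhat) \<le> (1 + M / \<beta>) * m \<and>
         (\<forall>x\<in>X n. norm (xs n - x) \<le> M / \<beta> * norm (x - xhat)) \<and>
         (hilbertian TYPE('z) \<longrightarrow> norm (xs n - xhat) \<le> M / \<beta> * m))"
    using ex1 m est quasi by blast
qed

end
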